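(* Let $A, B \in \mathcal{K}^d_{kc}$. Let $X \in A \ominus_e B$ and let $\delta=d_H(A,B \oplus X)$ be the minimum distance. Then for every two elements $X_1, X_2 \in A \ominus_e B$, $d_H(X_1,X_2) \leq 2\delta$. Moreover, for any $K \in \mathcal{K}^d_{kc}$, $d_H(X_1,X_2) \leq 2d_H(A,B \oplus K)$, including for $K=\{0\}$. Moreover, if there exists $X \in A \ominus_e B$ such that $A = B \oplus X$, then $A \ominus_e B$ is a singleton.
   Context: $\mathcal{K}^d_{kc}$ is the set of all nonempty compact convex subsets of Euclidean space $\mathbb{R}^d$ (with norm $\|\cdot\|$). Minkowski sum: $A\oplus B=\{a+b: a\in A, b\in B\}$. Hausdorff distance: $d_H(A,B)=\max\{\sup_{a\in A}\inf_{b\in B}\|a-b\|,\ \sup_{b\in B}\inf_{a\in A}\|a-b\|\}$. The extended set difference of $A,B\in\mathcal{K}^d_{kc}$ is the collection of minimizers $A\ominus_e B=\{X\in\mathcal{K}^d_{kc}: d_H(A,B\oplus X)=\inf_{Y\in\mathcal{K}^d_{kc}} d_H(A,B\oplus Y)\}$. *)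

theory Defs
  imports "HOL-Analysis.Analysis"
begin

definition convex_compacts :: "'a::euclidean_space set set" where
  "convex_compacts = {X. X \<noteq> {} \<and> compact X \<and> convex X}"

(* Suprema and infima are taken in the reals, so this is the Hausdorff distance
   only for nonempty bounded sets. *)
definition hausdorff_dist :: "'a::euclidean_space set \<Rightarrow> 'a set \<Rightarrow> real" where
  "hausdorff_dist A B =
     max (SUP a\<in>A. INF b\<in>B. norm (a - b)) (SUP b\<in>B. INF a\<in>A. norm (a - b))"

(* B + X is the Minkowski sum, i.e. set addition from HOL-Library.Set_Algebras. *)
definition ext_diff :: "'a::euclidean_space set \<Rightarrow> 'a set \<Rightarrow> 'a set set"
    (infixl \<open>\<ominus>\<^sub>e\<close> 65) where
  "A \<ominus>\<^sub>e B =
     {X \<in> convex_compacts.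
        hausdorff_dist A (B + X) = (INF Y\<in>convex_compacts. hausdorff_dist A (B + Y))}"

end

theory Submission
  imports Defs
begin

text \<open>
  Closeness in the Hausdorff distance is a pair of inclusions: \<open>hausdorff_dist A B \<le> r\<close> says that
  each of \<open>A\<close>, \<open>B\<close> lies in the other one thickened by the ball of radius \<open>r\<close>. If \<open>X1\<close> and \<open>X2\<close>
  both minimize, then \<open>B + X1\<close> lies in the \<open>\<delta>\<close>-thickening of \<open>A\<close>, which lies in the
  \<open>2 * \<delta>\<close>-thickening of \<open>B + X2\<close>. Thickening is itself addition of a compact convex set, so \<open>B\<close>
  occurs as a summand on both sides, and Radstrom's order cancellation law for Minkowski sums
  (\<open>set_plus_cancel_subset\<close>) removes it: \<open>X1\<close> lies in the \<open>2 * \<delta>\<close>-thickening of \<open>X2\<close>. This and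
  the symmetric inclusion bound the distance from \<open>X1\<close> to \<open>X2\<close> by \<open>2 * \<delta>\<close>
  (\<open>hausdorff_dist_summands\<close>).

  The remaining claims are consequences: \<open>\<delta>\<close> is a lower bound of the distances
  \<open>hausdorff_dist A (B + K)\<close> over all compact convex \<open>K\<close>, and in the case \<open>A = B + X\<close> it is zero,
  so that any two minimizers coincide.
\<close>

text \<open>Radstrom's order cancellation law. If \<open>x \<in> X\<close> were outside \<open>Y\<close>, some linear functional would
  be strictly smaller at \<open>x\<close> than everywhere on \<open>Y\<close>; adding to \<open>x\<close> a point of \<open>B\<close> at which this
  functional is minimal gives a point of \<open>B + X\<close> where it is smaller than everywhere on
  \<open>B + Y\<close>.\<close>

lemma set_plus_cancel_subset:
  fixes B X Y :: "'a::euclidean_space set"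
  assumes "compact B" "B \<noteq> {}" "closed Y" "convex Y" and sub: "B + X \<subseteq> B + Y"
  shows "X \<subseteq> Y"
proof
  fix x assume "x \<in> X"
  show "x \<in> Y"
  proof (rule ccontr)
    assume "x \<notin> Y"
    then obtain u c where ux: "u \<bullet> x < c" and uY: "\<And>y. y \<in> Y \<Longrightarrow> c < u \<bullet> y"
      using separating_hyperplane_closed_point[OF \<open>convex Y\<close> \<open>closed Y\<close>] by blast
    have "continuous_on B (\<lambda>b. u \<bullet> b)"
      by (intro continuous_intros)
    then obtain b where "b \<in> B" and b_min: "\<And>b'. b' \<in> B \<Longrightarrow> u \<bullet> b \<le> u \<bullet> b'"
      using continuous_attains_inf[OF \<open>compact B\<close> \<open>B \<noteq> {}\<close>] by blast
    have "b + x \<in> B + Y"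
      using sub \<open>b \<in> B\<close> \<open>x \<in> X\<close> by (auto intro: set_plus_intro)
    then obtain b' y where "b' \<in> B" "y \<in> Y" "b + x = b' + y"
      by (auto elim: set_plus_elim)
    then have "u \<bullet> b + u \<bullet> x = u \<bullet> b' + u \<bullet> y"
      by (metis inner_add_right)
    with ux uY[OF \<open>y \<in> Y\<close>] b_min[OF \<open>b' \<in> B\<close>] show False
      by linarith
  qed
qed

lemma infdist_eq_INF_norm: "B \<noteq> {} \<Longrightarrow> infdist a B = (INF b\<in>B. norm (a - b))"
  by (simp add: infdist_notempty dist_norm)

text \<open>Closedness of \<open>B\<close> makes the infimum an attained one, so that the non-strict bound is captured
  by the closed ball.\<close>

lemma subset_thickening_iff:
  fixes A B :: "'a::euclidean_space set"
  assumes "closed B" "B \<noteq> {}"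
  shows "A \<subseteq> B + cball 0 r \<longleftrightarrow> (\<forall>a\<in>A. infdist a B \<le> r)"
proof -
  have "a \<in> B + cball 0 r \<longleftrightarrow> infdist a B \<le> r" for a
  proof
    assume "a \<in> B + cball 0 r"
    then obtain b v where "a = b + v" "b \<in> B" "norm v \<le> r"
      by (auto elim: set_plus_elim)
    then show "infdist a B \<le> r"
      using infdist_le[of b B a] by (simp add: dist_norm)
  next
    assume "infdist a B \<le> r"
    moreover obtain b where "b \<in> B" "infdist a B = dist a b"
      using infdist_attains_inf[OF assms] by blast
    ultimately have "b + (a - b) \<in> B + cball 0 r"
      by (intro set_plus_intro) (auto simp: dist_norm norm_minus_commute)
    then show "a \<in> B + cball 0 r"
      by simp
  qed
  then show ?thesis
    by blast
qed

lemma SUP_infdist_le_iff: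
  fixes A B :: "'a::euclidean_space set"
  assumes "compact A" "A \<noteq> {}"
  shows "(SUP a\<in>A. infdist a B) \<le> r \<longleftrightarrow> (\<forall>a\<in>A. infdist a B \<le> r)"
proof -
  have "compact ((\<lambda>a. infdist a B) ` A)"
    using \<open>compact A\<close> by (intro compact_continuous_image continuous_intros)
  then have "bdd_above ((\<lambda>a. infdist a B) ` A)"
    by (simp add: bounded_imp_bdd_above compact_imp_bounded)
  with \<open>A \<noteq> {}\<close> show ?thesis
    by (simp add: cSUP_le_iff)
qed

lemma hausdorff_dist_le_iff:
  fixes A B :: "'a::euclidean_space set"
  assumes A: "compact A" "A \<noteq> {}" and B: "compact B" "B \<noteq> {}"
  shows "hausdorff_dist A B \<le> r \<longleftrightarrow> A \<subseteq> B + cball 0 r \<and> B \<subseteq> A + cball 0 r"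
proof -
  have "hausdorff_dist A B = max (SUP a\<in>A. infdist a B) (SUP b\<in>B. infdist b A)"
    using A B by (simp add: hausdorff_dist_def infdist_eq_INF_norm norm_minus_commute)
  then show ?thesis
    using A B by (simp add: SUP_infdist_le_iff subset_thickening_iff compact_imp_closed)
qed

lemma hausdorff_dist_nonneg:
  fixes A B :: "'a::euclidean_space set"
  assumes "compact A" "A \<noteq> {}" "compact B" "B \<noteq> {}"
  shows "0 \<le> hausdorff_dist A B"
proof (rule ccontr)
  \<comment> \<open>A ball of negative radius is empty, and so would be the thickening that contains \<open>A\<close>.\<close>
  assume "\<not> 0 \<le> hausdorff_dist A B"
  then have "cball (0::'a) (hausdorff_dist A B) = {}"
    by simp
  moreover have "A \<subseteq> B + cball 0 (hausdorff_dist A B)"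
    using hausdorff_dist_le_iff[OF assms] by blast
  ultimately show False
    using \<open>A \<noteq> {}\<close> by (auto simp: set_plus_def)
qed

lemma hausdorff_dist_self:
  fixes A :: "'a::euclidean_space set"
  assumes "compact A" "A \<noteq> {}"
  shows "hausdorff_dist A A = 0"
  using hausdorff_dist_le_iff[OF assms assms, of 0] hausdorff_dist_nonneg[OF assms assms]
  by (simp flip: set_zero)

lemma hausdorff_dist_le_0_imp_eq:
  fixes A B :: "'a::euclidean_space set"
  assumes "compact A" "A \<noteq> {}" "compact B" "B \<noteq> {}" "hausdorff_dist A B \<le> 0"
  shows "A = B"
  using hausdorff_dist_le_iff[OF assms(1-4), of 0] assms(5)
  by (auto simp flip: set_zero)

lemma cball_plus_cball_subset: "cball (0::'a::real_normed_vector) r + cball 0 s \<subseteq> cball 0 (r + s)"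
  by (force elim: set_plus_elim intro: norm_triangle_mono)

lemma compact_set_plus:
  fixes A B :: "'a::real_normed_vector set"
  assumes "compact A" "compact B"
  shows "compact (A + B)"
proof -
  have "A + B = (\<Union>x\<in>A. \<Union>y\<in>B. {x + y})"
    by (auto simp: set_plus_def)
  then show ?thesis
    using compact_sums'[OF assms] by simp
qed

lemma set_plus_nonempty: "A \<noteq> {} \<Longrightarrow> B \<noteq> {} \<Longrightarrow> A + B \<noteq> {}"
  by (auto simp: set_plus_def)

text \<open>The triangle inequality and the cancellation law at once: passing from \<open>B + X1\<close> through \<open>A\<close>
  to \<open>B + X2\<close> leaves \<open>B\<close> as a summand on both sides.\<close>

lemma summand_subset_thickening:
  fixes A B X1 X2 :: "'a::euclidean_space set"
  assumes B: "compact B" "B \<noteq> {}" and X2: "compact X2" "convex X2"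
    and 1: "B + X1 \<subseteq> A + cball 0 r" and 2: "A \<subseteq> (B + X2) + cball 0 s"
  shows "X1 \<subseteq> X2 + cball 0 (r + s)"
proof (rule set_plus_cancel_subset[OF B])
  have "B + X1 \<subseteq> ((B + X2) + cball 0 s) + cball 0 r"
    using 1 set_plus_mono2[OF 2 order_refl] by (rule order_trans)
  also have "\<dots> = (B + X2) + (cball 0 r + cball 0 s)"
    by (simp add: ac_simps)
  also have "\<dots> \<subseteq> (B + X2) + cball 0 (r + s)"
    by (intro set_plus_mono2 order_refl cball_plus_cball_subset)
  finally show "B + X1 \<subseteq> B + (X2 + cball 0 (r + s))"
    by (simp add: ac_simps)
  show "closed (X2 + cball 0 (r + s))"
    using X2 by (simp add: compact_imp_closed compact_set_plus)
  show "convex (X2 + cball 0 (r + s))"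
    using X2 by (simp add: convex_set_plus)
qed

lemma hausdorff_dist_summands:
  fixes A B X1 X2 :: "'a::euclidean_space set"
  assumes A: "compact A" "A \<noteq> {}" and B: "compact B" "B \<noteq> {}"
    and X1: "X1 \<in> convex_compacts" and X2: "X2 \<in> convex_compacts"
  shows "hausdorff_dist X1 X2 \<le> hausdorff_dist A (B + X1) + hausdorff_dist A (B + X2)"
proof -
  have incl: "A \<subseteq> (B + X) + cball 0 (hausdorff_dist A (B + X))"
    "B + X \<subseteq> A + cball 0 (hausdorff_dist A (B + X))" if "X \<in> convex_compacts" for X
    using hausdorff_dist_le_iff[of A "B + X" "hausdorff_dist A (B + X)"] A B that
    by (auto simp: convex_compacts_def compact_set_plus set_plus_nonempty)
  have "X1 \<subseteq> X2 + cball 0 (hausdorff_dist A (B + X1) + hausdorff_dist A (B + X2))"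
    using X2 summand_subset_thickening[OF B _ _ incl(2)[OF X1] incl(1)[OF X2]]
    by (simp add: convex_compacts_def)
  moreover have "X2 \<subseteq> X1 + cball 0 (hausdorff_dist A (B + X1) + hausdorff_dist A (B + X2))"
    using X1 summand_subset_thickening[OF B _ _ incl(2)[OF X2] incl(1)[OF X1]]
    by (simp add: convex_compacts_def add.commute)
  ultimately show ?thesis
    using X1 X2 by (simp add: convex_compacts_def hausdorff_dist_le_iff)
qed

lemma ext_diff_minimal:
  fixes A B :: "'a::euclidean_space set"
  assumes A: "A \<in> convex_compacts" and B: "B \<in> convex_compacts"
    and X: "X \<in> A \<ominus>\<^sub>e B" and K: "K \<in> convex_compacts"
  shows "hausdorff_dist A (B + X) \<le> hausdorff_dist A (B + K)"
proof -
  have "bdd_below ((\<lambda>Y. hausdorff_dist A (B + Y)) ` convex_compacts)"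
    using A B by (intro bdd_belowI2[where m = 0] hausdorff_dist_nonneg)
      (auto simp: convex_compacts_def compact_set_plus set_plus_nonempty)
  from cINF_lower[OF this K] X show ?thesis
    by (simp add: ext_diff_def)
qed

theorem theorem6:
  fixes A B :: "(real ^ 'd) set"
  assumes "A \<in> convex_compacts" and "B \<in> convex_compacts"
  shows "(\<forall>X \<in> A \<ominus>\<^sub>e B. \<forall>\<delta>. \<delta> = hausdorff_dist A (B + X) \<longrightarrow>
            (\<forall>X1 \<in> A \<ominus>\<^sub>e B. \<forall>X2 \<in> A \<ominus>\<^sub>e B. hausdorff_dist X1 X2 \<le> 2 * \<delta>)) \<and>
         (\<forall>X1 \<in> A \<ominus>\<^sub>e B. \<forall>X2 \<in> A \<ominus>\<^sub>e B.
            (\<forall>K \<in> convex_compacts. hausdorff_dist X1 X2 \<le> 2 * hausdorff_dist A (B + K)) \<and>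
            hausdorff_dist X1 X2 \<le> 2 * hausdorff_dist A (B + {0})) \<and>
         ((\<exists>X \<in> A \<ominus>\<^sub>e B. A = B + X) \<longrightarrow> is_singleton (A \<ominus>\<^sub>e B))"
proof -
  have A: "compact A" "A \<noteq> {}" and B: "compact B" "B \<noteq> {}"
    using assms by (auto simp: convex_compacts_def)
  have cc: "X \<in> convex_compacts" if "X \<in> A \<ominus>\<^sub>e B" for X
    using that by (simp add: ext_diff_def)
  have bound: "hausdorff_dist X1 X2 \<le> 2 * hausdorff_dist A (B + K)"
    if "X1 \<in> A \<ominus>\<^sub>e B" "X2 \<in> A \<ominus>\<^sub>e B" "K \<in> convex_compacts" for X1 X2 K
    using hausdorff_dist_summands[OF A B cc[OF that(1)] cc[OF that(2)]]
      ext_diff_minimal[OF assms that(1,3)] ext_diff_minimal[OF assms that(2,3)]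
    by linarith
  have singleton: "is_singleton (A \<ominus>\<^sub>e B)" if X: "X \<in> A \<ominus>\<^sub>e B" and "A = B + X" for X
  proof (rule is_singletonI')
    show "A \<ominus>\<^sub>e B \<noteq> {}"
      using X by blast
    fix X1 X2 assume "X1 \<in> A \<ominus>\<^sub>e B" "X2 \<in> A \<ominus>\<^sub>e B"
    moreover have "hausdorff_dist A (B + X) = 0"
      using hausdorff_dist_self[OF A] \<open>A = B + X\<close> by simp
    ultimately have "hausdorff_dist X1 X2 \<le> 0"
      using bound[OF _ _ cc[OF X]] by force
    then show "X1 = X2"
      using cc[OF \<open>X1 \<in> _\<close>] cc[OF \<open>X2 \<in> _\<close>]
      by (intro hausdorff_dist_le_0_imp_eq) (simp_all add: convex_compacts_def)
  qed
  have "{0} \<in> convex_compacts"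
    by (simp add: convex_compacts_def)
  then show ?thesis
    using bound cc singleton by blast
qed

end
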